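(* Let $n\ge 1$, let $a_1,\ldots,a_{n+1}>0$ and $k>1$ be fixed, and let $h(\boldsymbol{x},z)=-\sum_{i=1}^n\frac{x_i^2}{a_i^2}+\frac{z^2}{a_{n+1}^2}$. Put $$G_0(t)=\frac{\pi^{n/2}}{\Gamma(n/2+1)}\int_1^t(\zeta^2-1)^{n/2}\,d\zeta,\qquad G(t)=a_1\cdots a_{n+1}\,G_0(t)\qquad(t\ge 1).$$ Every hyperplane tangent to any sheet of the hyperboloid $h(\boldsymbol{x},z)=k^2$ cuts off from the corresponding sheet of the homothetic hyperboloid $h(\boldsymbol{x},z)=1$ a compact $(n+1)$-dimensional set of constant Euclidean volume $G(k)$. Conversely, let $\mathcal{M}\colon z=f(\boldsymbol{x})$, with $f\in C^{2}(\mathbb{R}^n)$ real-valued, be a surface lying inside the upper sheet of the hyperboloid $h(\boldsymbol{x},z)=1$. Suppose that for every point $P=(\overline{\boldsymbol{x}},\overline{z})$ of $\mathcal{M}$, with $\overline{z}=f(\overline{\boldsymbol{x}})$ and $\overline{p_i}=\frac{\partial f}{\partial x_i}(\overline{\boldsymbol{x}})$ for $i=1,\ldots,n$, the hyperplane tangent to $\mathcal{M}$ at $P$ verifies the conditions $$a_{n+1}^2-\sum_{i=1}^na_i^2\overline{p_i}^2>0\quad\text{and}\quad \overline{z}-\sum_{i=1}^n\overline{p_i}\,\overline{x_i}\ge\sqrt{a_{n+1}^2-\sum_{i=1}^na_i^2\overline{p_i}^2},$$ and cuts off from the upper sheet of $h(\boldsymbol{x},z)=1$ a compact set of constant (independent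 of $P$) $(n+1)$-dimensional Euclidean volume $V$. Then $\mathcal{M}$ is the upper sheet of the hyperboloid $h(\boldsymbol{x},z)=k^2$, where $k=G^{-1}(V)$ (and $k>1$).
   Context: Points of the Euclidean space $E^{n+1}$ are written $(\boldsymbol{x},z)=(x_1,\ldots,x_n,z)$. For $c>0$, the upper (resp. lower) sheet of $h(\boldsymbol{x},z)=c$ is its part in $\{z>0\}$ (resp. $\{z<0\}$); corresponding sheets are those lying in the same half-space. The surface $z=f(\boldsymbol{x})$ lies inside the upper sheet of $h=1$ if $f(\boldsymbol{x})>0$ and $h(\boldsymbol{x},f(\boldsymbol{x}))>1$ for all $\boldsymbol{x}$. The compact set cut off from the upper sheet of $h=1$ by a hyperplane $z=\sum_{i=1}^n m_ix_i+c$ is $\{(\boldsymbol{x},z): z>0,\ h(\boldsymbol{x},z)\ge 1,\ z\le\sum_{i=1}^n m_ix_i+c\}$; for the lower sheet it is the set obtained symmetrically, $\{(\boldsymbol{x},z): z<0,\ h(\boldsymbol{x},z)\ge 1,\ z\ge\sum_{i=1}^n m_ix_i+c\}$. *)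

theory Defs
  imports "HOL-Analysis.Analysis"
begin

text \<open>
  The space \<open>E\<^sup>n\<^sup>+\<^sup>1\<close> is rendered as \<open>(real ^ 'n) \<times> real\<close>, with \<open>n = CARD('n) \<ge> 1\<close>; its norm
  is the Euclidean one and \<open>lborel\<close> is the \<open>(n+1)\<close>-dimensional Lebesgue measure.
  The semi-axes \<open>a\<^sub>1, \<dots>, a\<^sub>n\<close> are the components of \<open>a\<close>, and \<open>b\<close> stands for \<open>a\<^sub>n\<^sub>+\<^sub>1\<close>.
\<close>

definition hyp_form :: "real ^ 'n \<Rightarrow> real \<Rightarrow> (real ^ 'n) \<times> real \<Rightarrow> real" where
  "hyp_form a b = (\<lambda>(x, z). - (\<Sum>i\<in>UNIV. (x $ i)\<^sup>2 / (a $ i)\<^sup>2) + z\<^sup>2 / b\<^sup>2)"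

definition upper_sheet :: "real ^ 'n \<Rightarrow> real \<Rightarrow> real \<Rightarrow> ((real ^ 'n) \<times> real) set" where
  "upper_sheet a b c = {(x, z). hyp_form a b (x, z) = c \<and> z > 0}"

definition lower_sheet :: "real ^ 'n \<Rightarrow> real \<Rightarrow> real \<Rightarrow> ((real ^ 'n) \<times> real) set" where
  "lower_sheet a b c = {(x, z). hyp_form a b (x, z) = c \<and> z < 0}"

definition graph_hyperplane :: "real ^ 'n \<Rightarrow> real \<Rightarrow> ((real ^ 'n) \<times> real) set" where
  "graph_hyperplane m c = {(x, z). z = (\<Sum>i\<in>UNIV. m $ i * x $ i) + c}"

text \<open>The sets cut off from the sheets of \<open>h = 1\<close> by \<open>graph_hyperplane m c\<close>.\<close>

definition upper_cut :: "real ^ 'n \<Rightarrow> real \<Rightarrow> real ^ 'n \<Rightarrow> real \<Rightarrow> ((real ^ 'n) \<times> real) set" where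
  "upper_cut a b m c =
     {(x, z). z > 0 \<and> hyp_form a b (x, z) \<ge> 1 \<and> z \<le> (\<Sum>i\<in>UNIV. m $ i * x $ i) + c}"

definition lower_cut :: "real ^ 'n \<Rightarrow> real \<Rightarrow> real ^ 'n \<Rightarrow> real \<Rightarrow> ((real ^ 'n) \<times> real) set" where
  "lower_cut a b m c =
     {(x, z). z < 0 \<and> hyp_form a b (x, z) \<ge> 1 \<and> z \<ge> (\<Sum>i\<in>UNIV. m $ i * x $ i) + c}"

text \<open>
  The hyperplane tangent at \<open>P\<close> to the level set of \<open>F\<close> through \<open>P\<close>; meaningful where \<open>F\<close> is
  differentiable with nonzero derivative.
\<close>

definition level_tangent_hyperplane :: "('a::real_normed_vector \<Rightarrow> real) \<Rightarrow> 'a \<Rightarrow> 'a set" where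
  "level_tangent_hyperplane F P = {Q. frechet_derivative F (at P) (Q - P) = 0}"

definition G0 :: "nat \<Rightarrow> real \<Rightarrow> real" where
  "G0 n t = pi powr (real n / 2) / Gamma (real n / 2 + 1)
              * integral {1..t} (\<lambda>\<zeta>. (\<zeta>\<^sup>2 - 1) powr (real n / 2))"

definition G :: "real ^ 'n \<Rightarrow> real \<Rightarrow> real \<Rightarrow> real" where
  "G a b t = (\<Prod>i\<in>UNIV. a $ i) * b * G0 CARD('n) t"

text \<open>The inverse of \<open>G\<close> as a function on \<open>[1, \<infinity>)\<close>.\<close>

definition G_inv :: "real ^ 'n \<Rightarrow> real \<Rightarrow> real \<Rightarrow> real" where
  "G_inv a b = the_inv_into {1..} (G a b)"

definition C2 :: "('a::real_normed_vector \<Rightarrow> real) \<Rightarrow> bool" where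
  "C2 f \<longleftrightarrow> (\<exists>(f' :: 'a \<Rightarrow> 'a \<Rightarrow>\<^sub>L real) (f'' :: 'a \<Rightarrow> 'a \<Rightarrow>\<^sub>L 'a \<Rightarrow>\<^sub>L real).
      (\<forall>x. (f has_derivative blinfun_apply (f' x)) (at x)) \<and>
      (\<forall>x. (f' has_derivative blinfun_apply (f'' x)) (at x)) \<and>
      continuous_on UNIV f'')"

definition partial_deriv :: "(real ^ 'n \<Rightarrow> real) \<Rightarrow> 'n \<Rightarrow> real ^ 'n \<Rightarrow> real" where
  "partial_deriv f i x = deriv (\<lambda>t. f (x + t *\<^sub>R axis i 1)) 0"

definition gradient :: "(real ^ 'n \<Rightarrow> real) \<Rightarrow> real ^ 'n \<Rightarrow> real ^ 'n" where
  "gradient f x = (\<chi> i. partial_deriv f i x)"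

text \<open>
  The hyperplane tangent to \<open>z = f x\<close> at \<open>(x, f x)\<close> is
  \<open>graph_hyperplane (gradient f x) (tangent_intercept f x)\<close>.
\<close>

definition tangent_intercept :: "(real ^ 'n \<Rightarrow> real) \<Rightarrow> real ^ 'n \<Rightarrow> real" where
  "tangent_intercept f x = f x - (\<Sum>i\<in>UNIV. partial_deriv f i x * x $ i)"

end

(*
  Volume: minus the Minkowski reflection in the sum of two unit timelike vectors is a linear
  involution, hence preserves Lebesgue measure, and preserves h; it carries every cut to a horizontal
  cut {z <= b t}, whose slices are ellipsoids and whose volume is G(t), with
  t = c / sqrt (b^2 - sum a_i^2 m_i^2) for the hyperplane z = m.x + c.

  Converse: G is injective, so t is a constant k along the surface; with all semi-axes normalised to 1
  this is the Clairaut equation f - x.p = k sqrt (1 - |p|^2), where p is the gradient of f.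
  Such f satisfies psi = f^2 - |x|^2 <= k^2. The infimum of psi need not be attained, so minimise
  ln psi + eps ln f instead: f > |x| makes this coercive, and at a minimum the Clairaut equation
  yields psi >= k^2 - O(eps^2). Letting eps tend to 0 gives psi = k^2 everywhere.
*)
theory Submission
  imports Defs
begin

subsection \<open>Linear involutions preserve Lebesgue measure\<close>

lemma nn_integral_lborel_translation:
  fixes t :: "'a::euclidean_space"
  assumes [measurable]: "f \<in> borel_measurable borel"
  shows "(\<integral>\<^sup>+x. f (t + x) \<partial>lborel) = (\<integral>\<^sup>+x. f x \<partial>lborel)"
  by (subst lborel_distr_plus[of t, symmetric]) (simp add: nn_integral_distr)

lemma nn_integral_lborel_reflection:
  fixes t :: "'a::euclidean_space"
  assumes [measurable]: "f \<in> borel_measurable borel"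
  shows "(\<integral>\<^sup>+x. f (t - x) \<partial>lborel) = (\<integral>\<^sup>+x. f x \<partial>lborel)"
proof -
  have "lborel = distr lborel borel (\<lambda>x. t - x)"
    using lborel_affine[of "-1" t] by (simp add: density_1)
  then have "(\<integral>\<^sup>+x. f x \<partial>lborel) = (\<integral>\<^sup>+x. f x \<partial>distr lborel borel (\<lambda>x. t - x))"
    by simp
  then show ?thesis
    by (simp add: nn_integral_distr)
qed

text \<open>
  Uniqueness of translation-invariant measures by Fubini: both sides equal the double integral of
  \<open>indicator A (R y) * indicator B (R y + x)\<close>.
\<close>

lemma linear_involution_emeasure_exchange:
  fixes R :: "'a::euclidean_space \<Rightarrow> 'a"
  assumes R: "linear R" "\<And>x. R (R x) = x"
    and [measurable]: "A \<in> sets borel" "B \<in> sets borel"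
  shows "emeasure lborel (R -` A) * emeasure lborel B = emeasure lborel (R -` B) * emeasure lborel A"
proof -
  have [measurable]: "R \<in> borel_measurable borel"
    using R(1) by (intro borel_measurable_continuous_onI linear_continuous_on) (simp add: linear_linear)
  have vim: "emeasure lborel (R -` C) = (\<integral>\<^sup>+y. indicator C (R y) \<partial>lborel)" if [measurable]: "C \<in> sets borel" for C
  proof -
    have "R -` C \<in> sets borel" using measurable_sets[of R borel borel C] by simp
    then have "emeasure lborel (R -` C) = (\<integral>\<^sup>+y. indicator (R -` C) y \<partial>lborel)" by simp
    also have "\<dots> = (\<integral>\<^sup>+y. indicator C (R y) \<partial>lborel)" by (intro nn_integral_cong) (auto simp: indicator_def)
    finally show ?thesis .
  qed
  have "emeasure lborel (R -` A) * emeasure lborel B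
      = (\<integral>\<^sup>+y. indicator A (R y) * (\<integral>\<^sup>+x. indicator B x \<partial>lborel) \<partial>lborel)"
    by (simp add: vim nn_integral_multc)
  also have "\<dots> = (\<integral>\<^sup>+y. indicator A (R y) * (\<integral>\<^sup>+x. indicator B (R y + x) \<partial>lborel) \<partial>lborel)"
    by (subst nn_integral_lborel_translation) auto
  also have "\<dots> = (\<integral>\<^sup>+y. (\<integral>\<^sup>+x. indicator A (R y) * indicator B (R y + x) \<partial>lborel) \<partial>lborel)"
    by (simp add: nn_integral_cmult)
  also have "\<dots> = (\<integral>\<^sup>+x. (\<integral>\<^sup>+y. indicator A (R y) * indicator B (R y + x) \<partial>lborel) \<partial>lborel)"
    by (intro lborel_pair.Fubini') measurable
  also have "\<dots> = (\<integral>\<^sup>+x. (\<integral>\<^sup>+y. indicator A (R y - x) * indicator B (R y) \<partial>lborel) \<partial>lborel)"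
  proof (rule nn_integral_cong)
    \<comment> \<open>Translating \<open>y\<close> by \<open>- R x\<close> replaces
      \<open>R y\<close> by \<open>R y - x\<close>, because \<open>R\<close> is linear and
      \<open>R (R x) = x\<close>. The shift thereby moves from \<open>B\<close> to
      \<open>A\<close>.\<close>
    fix x
    have "(\<integral>\<^sup>+y. indicator A (R y) * indicator B (R y + x) \<partial>lborel)
        = (\<integral>\<^sup>+y. indicator A (R (- R x + y)) * indicator B (R (- R x + y) + x) \<partial>lborel)"
      by (rule nn_integral_lborel_translation[symmetric]) measurable
    also have "\<dots> = (\<integral>\<^sup>+y. indicator A (R y - x) * indicator B (R y) \<partial>lborel)"
      using R by (simp add: linear_add linear_diff linear_neg)
    finally show "(\<integral>\<^sup>+y. indicator A (R y) * indicator B (R y + x) \<partial>lborel)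
        = (\<integral>\<^sup>+y. indicator A (R y - x) * (indicator B (R y) :: ennreal) \<partial>lborel)" .
  qed
  also have "\<dots> = (\<integral>\<^sup>+y. (\<integral>\<^sup>+x. indicator A (R y - x) * indicator B (R y) \<partial>lborel) \<partial>lborel)"
    by (intro lborel_pair.Fubini') measurable
  also have "\<dots> = (\<integral>\<^sup>+y. (\<integral>\<^sup>+x. indicator A (R y - x) \<partial>lborel) * indicator B (R y) \<partial>lborel)"
    by (simp add: nn_integral_multc)
  also have "\<dots> = (\<integral>\<^sup>+y. emeasure lborel A * indicator B (R y) \<partial>lborel)"
    by (subst nn_integral_lborel_reflection) auto
  also have "\<dots> = emeasure lborel (R -` B) * emeasure lborel A"
    by (simp add: vim nn_integral_cmult mult.commute)
  finally show ?thesis .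
qed

text \<open>An \<open>R\<close>-invariant test set of finite positive measure can be cancelled from
  the exchange identity, so no determinant has to be computed.\<close>

lemma emeasure_lborel_linear_involution:
  fixes R :: "'a::euclidean_space \<Rightarrow> 'a"
  assumes R: "linear R" "\<And>x. R (R x) = x" and A: "A \<in> sets borel"
  shows "emeasure lborel (R -` A) = emeasure lborel A"
proof -
  \<comment> \<open>\<open>R\<close> interchanges the two pieces, so \<open>B\<close> is invariant.
    It contains the unit ball, hence has positive measure, and it is bounded because the second
    piece is also the linear image of the ball.\<close>
  define B where "B = ball 0 1 \<union> R -` ball 0 1"
  have cont: "continuous_on UNIV R"
    using R(1) by (intro linear_continuous_on) (simp add: linear_linear)
  have inv: "R -` B = B"
    using R(2) by (auto simp: B_def)
  have "open (R -` ball 0 1)"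
    using cont by (simp add: open_vimage)
  then have borel: "B \<in> sets borel"
    by (simp add: B_def)
  have "R -` ball 0 1 = R ` ball 0 1"
    using R(2) by (metis bij_image_Collect_eq bij_vimage_eq_inv_image inv_equality involuntory_imp_bij)
  then have "bounded B"
    using R(1) by (simp add: B_def bounded_linear_image linear_linear)
  then have fin: "emeasure lborel B \<noteq> \<infinity>"
    using emeasure_bounded_finite[of B] by auto
  have "0 < emeasure lborel (ball (0::'a) 1)"
    by (simp add: emeasure_ball)
  also have "\<dots> \<le> emeasure lborel B"
    using borel by (intro emeasure_mono) (auto simp: B_def)
  finally have pos: "emeasure lborel B \<noteq> 0" by simp
  have "emeasure lborel B * emeasure lborel (R -` A) = emeasure lborel B * emeasure lborel A"
    using linear_involution_emeasure_exchange[OF R A borel] inv by (simp add: mult.commute)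
  then show ?thesis
    using fin pos by (simp add: ennreal_mult_cancel_left infinity_ennreal_def)
qed

subsection \<open>Volumes of the cuts\<close>

lemma G0_strict_mono:
  assumes "0 < n" "1 \<le> s" "s < t"
  shows "G0 n s < G0 n t"
proof -
  define g :: "real \<Rightarrow> real" where "g = (\<lambda>\<zeta>. (\<zeta>\<^sup>2 - 1) powr (real n / 2))"
  \<comment> \<open>At 1 the base of the power vanishes; continuity there relies on the exponent n/2
    being positive.\<close>
  have cont: "continuous_on {u..v} g" if "1 \<le> u" for u v
    unfolding g_def using that assms(1) by (intro continuous_on_powr') (auto intro!: continuous_intros)
  have "integral {s..t} (\<lambda>_. 0) < integral {s..t} g"
  proof (rule integral_less_real)
    show "0 < g \<zeta>" if "\<zeta> \<in> {s<..<t}" for \<zeta>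
      using that assms by (simp add: g_def) (smt (verit) one_less_power zero_less_numeral)
  qed (use assms cont in auto)
  moreover have "integral {1..s} g + integral {s..t} g = integral {1..t} g"
    using assms cont[of 1 t]
    by (intro Henstock_Kurzweil_Integration.integral_combine integrable_continuous_real) auto
  moreover have "unit_ball_vol n > 0" by simp
  ultimately show ?thesis
    unfolding G0_def g_def[symmetric] unit_ball_vol_def[symmetric] by simp
qed

section \<open>The Lorentzian bilinear form that polarises h\<close>

definition hyp_bilin :: "real ^ 'n \<Rightarrow> real \<Rightarrow> (real ^ 'n) \<times> real \<Rightarrow> (real ^ 'n) \<times> real \<Rightarrow> real" where
  "hyp_bilin a b P Q = - (\<Sum>i\<in>UNIV. fst P $ i * fst Q $ i / (a $ i)\<^sup>2) + snd P * snd Q / b\<^sup>2"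

lemma hyp_form_eq_bilin: "hyp_form a b P = hyp_bilin a b P P"
  by (cases P) (simp add: hyp_form_def hyp_bilin_def power2_eq_square)

lemma hyp_bilin_commute: "hyp_bilin a b P Q = hyp_bilin a b Q P"
  by (simp add: hyp_bilin_def mult.commute)

lemma hyp_bilin_add_left: "hyp_bilin a b (P + P') Q = hyp_bilin a b P Q + hyp_bilin a b P' Q"
  by (simp add: hyp_bilin_def distrib_right add_divide_distrib sum.distrib)

lemma hyp_bilin_scaleR_left: "hyp_bilin a b (r *\<^sub>R P) Q = r * hyp_bilin a b P Q"
  by (simp add: hyp_bilin_def sum_distrib_left right_diff_distrib mult.assoc)

lemma bounded_bilinear_hyp_bilin:
  fixes a :: "real ^ 'n"
  shows "bounded_bilinear (hyp_bilin a b)"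
proof -
  have "bilinear (hyp_bilin a b)"
    unfolding bilinear_def
  proof (intro conjI allI linearI)
    fix P Q Q' :: "(real ^ 'n) \<times> real" and r :: real
    show "hyp_bilin a b P (Q + Q') = hyp_bilin a b P Q + hyp_bilin a b P Q'"
      by (metis hyp_bilin_add_left hyp_bilin_commute)
    show "hyp_bilin a b P (r *\<^sub>R Q) = r *\<^sub>R hyp_bilin a b P Q"
      by (metis hyp_bilin_scaleR_left hyp_bilin_commute real_scaleR_def)
  qed (simp_all add: hyp_bilin_add_left hyp_bilin_scaleR_left)
  then show ?thesis by (simp add: bilinear_conv_bounded_bilinear)
qed

lemmas hyp_bilin_simps =
  bounded_bilinear.add_left[OF bounded_bilinear_hyp_bilin]
  bounded_bilinear.add_right[OF bounded_bilinear_hyp_bilin]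
  bounded_bilinear.diff_left[OF bounded_bilinear_hyp_bilin]
  bounded_bilinear.diff_right[OF bounded_bilinear_hyp_bilin]
  bounded_bilinear.scaleR_left[OF bounded_bilinear_hyp_bilin]
  bounded_bilinear.scaleR_right[OF bounded_bilinear_hyp_bilin]

lemma hyp_form_has_derivative:
  "(hyp_form a b has_derivative (\<lambda>h. 2 * hyp_bilin a b P h)) (at P)"
proof -
  have "hyp_form a b = (\<lambda>P. hyp_bilin a b P P)"
    by (simp add: fun_eq_iff hyp_form_eq_bilin)
  then show ?thesis
    using bounded_bilinear.FDERIV[OF bounded_bilinear_hyp_bilin has_derivative_ident has_derivative_ident, of a b P UNIV]
    by (simp add: hyp_bilin_commute[of a b _ P])
qed

lemma continuous_on_hyp_form: "continuous_on S (hyp_form a b)"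
  using hyp_form_has_derivative by (meson continuous_at_imp_continuous_on has_derivative_continuous)

locale hyperboloid =
  fixes a :: "real ^ 'n" and b :: real
  assumes a_pos: "\<And>i. a $ i > 0" and b_pos: "b > 0"
begin

text \<open>Cauchy-Schwarz for the products \<open>(a $ i * m $ i) * (x $ i / a $ i)\<close>.
  Consequently z and z - m.x have the same sign wherever h >= 1, which is how the reduction to
  horizontal cuts keeps track of the upper half-space.\<close>

lemma slope_inequality:
  assumes m: "(\<Sum>i\<in>UNIV. (a $ i)\<^sup>2 * (m $ i)\<^sup>2) < b\<^sup>2" and h: "hyp_form a b (x, z) \<ge> 1"
  shows "\<bar>\<Sum>i\<in>UNIV. m $ i * x $ i\<bar> < \<bar>z\<bar>"
proof -
  define M where "M = (\<Sum>i\<in>UNIV. (a $ i * m $ i)\<^sup>2)"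
  define X where "X = (\<Sum>i\<in>UNIV. (x $ i / a $ i)\<^sup>2)"
  have "M < b\<^sup>2" "0 \<le> M" using m by (auto simp: M_def power_mult_distrib sum_nonneg)
  moreover have "X + 1 \<le> z\<^sup>2 / b\<^sup>2" using h by (simp add: X_def hyp_form_def power_divide)
  moreover have "0 \<le> X" by (simp add: X_def sum_nonneg)
  moreover have "(\<Sum>i\<in>UNIV. m $ i * x $ i)\<^sup>2 \<le> M * X"
  proof -
    have "(\<Sum>i\<in>UNIV. m $ i * x $ i) = (\<Sum>i\<in>UNIV. (a $ i * m $ i) * (x $ i / a $ i))"
      using a_pos by (intro sum.cong) (auto simp: less_imp_neq[symmetric])
    then show ?thesis unfolding M_def X_def by (simp only: Cauchy_Schwarz_ineq_sum)
  qed
  moreover have "M * X < z\<^sup>2"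
  proof -
    have "M * X \<le> b\<^sup>2 * X" using \<open>M < b\<^sup>2\<close> \<open>0 \<le> X\<close> by (intro mult_right_mono) auto
    also have "\<dots> < b\<^sup>2 * (z\<^sup>2 / b\<^sup>2)"
      using \<open>X + 1 \<le> z\<^sup>2 / b\<^sup>2\<close> b_pos by (intro mult_strict_left_mono) auto
    finally show ?thesis using b_pos by simp
  qed
  ultimately have "(\<Sum>i\<in>UNIV. m $ i * x $ i)\<^sup>2 < z\<^sup>2" by linarith
  then show ?thesis by (simp add: abs_le_square_iff flip: not_le)
qed

section \<open>Horizontal cuts of the upper sheet\<close>

lemma standard_cut_eq:
  "upper_cut a b 0 (b * t) = {(x, z). b \<le> z \<and> z \<le> b * t \<and> (\<Sum>i\<in>UNIV. (x $ i)\<^sup>2 / (a $ i)\<^sup>2) + 1 \<le> z\<^sup>2 / b\<^sup>2}"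
proof -
  \<comment> \<open>Since h >= 1 forces z^2 >= b^2, the open condition \<open>z > 0\<close> can be
    traded for \<open>b \<le> z\<close>, which exhibits the cut as a closed set.\<close>
  have "b \<le> z" if "z > 0" "1 \<le> z\<^sup>2 / b\<^sup>2 - (\<Sum>i\<in>UNIV. (x $ i)\<^sup>2 / (a $ i)\<^sup>2)" for x :: "real ^ 'n" and z
  proof -
    have "0 \<le> (\<Sum>i\<in>UNIV. (x $ i)\<^sup>2 / (a $ i)\<^sup>2)" by (simp add: sum_nonneg)
    then have "1 \<le> z\<^sup>2 / b\<^sup>2" using that by linarith
    then have "b\<^sup>2 \<le> z\<^sup>2" using b_pos by (simp add: field_simps)
    then show ?thesis using that b_pos by (intro power2_le_imp_le[of b z]) auto
  qed
  then show ?thesis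
    using b_pos by (auto simp: upper_cut_def hyp_form_def)
qed

lemma closed_standard_cut: "closed (upper_cut a b 0 (b * t))"
proof -
  have "closed {P :: (real ^ 'n) \<times> real. b \<le> snd P \<and> snd P \<le> b * t \<and>
    (\<Sum>i\<in>UNIV. (fst P $ i)\<^sup>2 / (a $ i)\<^sup>2) + 1 \<le> (snd P)\<^sup>2 / b\<^sup>2}"
    using a_pos b_pos
    by (intro closed_Collect_conj closed_Collect_le continuous_intros) (auto simp: less_imp_neq[symmetric])
  then show ?thesis by (simp add: standard_cut_eq case_prod_unfold)
qed

text \<open>A single summand of the quadratic form is at most (z/b)^2 <= t^2, so the cut lies in a
  box with half-widths \<open>t * a $ i\<close>.\<close>

lemma compact_standard_cut: "compact (upper_cut a b 0 (b * t))"
proof -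
  have "upper_cut a b 0 (b * t) \<subseteq> cbox (- (t *\<^sub>R a)) (t *\<^sub>R a) \<times> {b..b * t}"
  proof (clarsimp simp: standard_cut_eq mem_box_cart)
    fix x z i assume z: "b \<le> z" "z \<le> b * t" and h: "(\<Sum>i\<in>UNIV. (x $ i)\<^sup>2 / (a $ i)\<^sup>2) + 1 \<le> z\<^sup>2 / b\<^sup>2"
    have "(x $ i)\<^sup>2 / (a $ i)\<^sup>2 \<le> (\<Sum>i\<in>UNIV. (x $ i)\<^sup>2 / (a $ i)\<^sup>2)"
      by (rule member_le_sum) auto
    also have "\<dots> \<le> z\<^sup>2 / b\<^sup>2" using h by simp
    also have "\<dots> = (z / b)\<^sup>2" by (simp add: power_divide)
    also have "\<dots> \<le> t\<^sup>2" using z b_pos by (intro power_mono) (auto simp: field_simps)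
    finally have "(x $ i / a $ i)\<^sup>2 \<le> t\<^sup>2" by (simp add: power_divide)
    then have "\<bar>x $ i / a $ i\<bar> \<le> \<bar>t\<bar>" by (simp only: abs_le_square_iff)
    moreover have "t > 0" using z b_pos by (smt (verit) zero_less_mult_pos)
    ultimately show "- (t * a $ i) \<le> x $ i \<and> x $ i \<le> t * a $ i"
      using a_pos[of i] by (auto simp: abs_le_iff field_simps)
  qed
  moreover have "compact (cbox (- (t *\<^sub>R a)) (t *\<^sub>R a) \<times> {b..b * t})"
    by (intro compact_Times compact_cbox compact_Icc)
  ultimately show ?thesis
    using closed_standard_cut by (meson compact_imp_bounded bounded_subset compact_eq_bounded_closed)
qed

text \<open>The ellipsoid is the image of the ball of radius \<open>r\<close> under a diagonal
  stretch whose determinant is the product of the semi-axes.\<close>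

lemma emeasure_ellipsoid:
  assumes "r \<ge> 0"
  shows "emeasure lborel {x. (\<Sum>i\<in>UNIV. (x $ i)\<^sup>2 / (a $ i)\<^sup>2) \<le> r\<^sup>2}
    = ennreal ((\<Prod>i\<in>UNIV. a $ i) * (unit_ball_vol CARD('n) * r ^ CARD('n)))"
proof -
  let ?E = "{x :: real ^ 'n. (\<Sum>i\<in>UNIV. (x $ i)\<^sup>2 / (a $ i)\<^sup>2) \<le> r\<^sup>2}"
  let ?S = "\<lambda>x. \<chi> i. a $ i * x $ i"
  have E: "?E = ?S ` cball 0 r"
  proof (rule set_eqI)
    fix x
    have norm: "(norm (\<chi> i. x $ i / a $ i))\<^sup>2 = (\<Sum>i\<in>UNIV. (x $ i)\<^sup>2 / (a $ i)\<^sup>2)"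
      by (simp add: power2_norm_eq_inner inner_vec_def power_divide flip: power2_eq_square)
    have "x \<in> ?S ` cball 0 r \<longleftrightarrow> norm (\<chi> i. x $ i / a $ i) \<le> r" (is "?l \<longleftrightarrow> ?r")
    proof
      assume ?l
      then obtain y where y: "x = ?S y" "norm y \<le> r" by auto
      have "(\<chi> i. x $ i / a $ i) = y"
        using a_pos by (simp add: y vec_eq_iff less_imp_neq[symmetric])
      with y show ?r by simp
    next
      assume ?r
      moreover have "x = ?S (\<chi> i. x $ i / a $ i)"
        using a_pos by (simp add: vec_eq_iff less_imp_neq[symmetric])
      ultimately show ?l by (intro image_eqI[of x ?S "\<chi> i. x $ i / a $ i"]) simp_all
    qed
    then show "x \<in> ?E \<longleftrightarrow> x \<in> ?S ` cball 0 r"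
      using assms norm by (metis (no_types, lifting) abs_le_square_iff abs_norm_cancel abs_of_nonneg mem_Collect_eq)
  qed
  have borel: "?E \<in> sets borel"
    using a_pos by (intro borel_closed closed_Collect_le continuous_intros) (auto simp: less_imp_neq[symmetric])
  have "bounded ?E"
  proof -
    have "linear ?S" by (rule linearI) (auto simp: vec_eq_iff algebra_simps)
    then show ?thesis unfolding E by (simp add: bounded_linear_image linear_linear)
  qed
  then have "emeasure lborel ?E = ennreal (measure lborel ?E)"
    using emeasure_bounded_finite[of ?E] by (intro emeasure_eq_ennreal_measure) auto
  also have "measure lborel ?E = measure lebesgue (?S ` cball 0 r)"
    using borel by (simp add: measure_completion E[symmetric])
  also have "\<dots> = \<bar>prod (($) a) UNIV\<bar> * measure lebesgue (cball (0 :: real ^ 'n) r)"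
    by (rule measure_stretch) simp
  also have "\<dots> = (\<Prod>i\<in>UNIV. a $ i) * (unit_ball_vol CARD('n) * r ^ CARD('n))"
    using assms a_pos by (simp add: content_cball measure_completion abs_prod abs_of_pos)
  finally show ?thesis .
qed

text \<open>Slicing at height \<open>b * \<zeta>\<close> gives an ellipsoid with
  \<open>r = sqrt (\<zeta>\<^sup>2 - 1)\<close>, hence the integrand of \<open>G0\<close>; the
  substitution z = b \<zeta> contributes the remaining factor \<open>b\<close>.\<close>

lemma emeasure_standard_cut:
  assumes "t \<ge> 1"
  shows "emeasure lborel (upper_cut a b 0 (b * t)) = ennreal (G a b t)"
proof -
  let ?A = "upper_cut a b 0 (b * t)"
  define g :: "real \<Rightarrow> real" where "g = (\<lambda>\<zeta>. (\<zeta>\<^sup>2 - 1) powr (real CARD('n) / 2))"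
  define c where "c = (\<Prod>i\<in>UNIV. a $ i) * unit_ball_vol CARD('n)"
  have c: "c \<ge> 0" unfolding c_def using a_pos by (intro mult_nonneg_nonneg prod_nonneg) (auto intro: less_imp_le)
  have "?A \<in> sets lborel" by (simp add: borel_closed closed_standard_cut)
  then have borel: "?A \<in> sets (lborel \<Otimes>\<^sub>M lborel)" by (simp only: lborel_prod)
  have slice: "emeasure lborel {x. (x, b * \<zeta>) \<in> ?A} = ennreal (c * g \<zeta>) * indicator {1..t} \<zeta>" for \<zeta>
  proof (cases "\<zeta> \<in> {1..t}")
    case True
    then have \<zeta>: "0 \<le> \<zeta>\<^sup>2 - 1" by simp
    then have sq: "(sqrt (\<zeta>\<^sup>2 - 1))\<^sup>2 = \<zeta>\<^sup>2 - 1" by simp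
    have "{x. (x, b * \<zeta>) \<in> ?A} = {x. (\<Sum>i\<in>UNIV. (x $ i)\<^sup>2 / (a $ i)\<^sup>2) \<le> (sqrt (\<zeta>\<^sup>2 - 1))\<^sup>2}"
      using True b_pos unfolding sq by (auto simp: standard_cut_eq power_mult_distrib)
    \<comment> \<open>The degenerate slice \<zeta> = 1 is treated apart: there \<open>powr\<close>
      with base 0 yields 0, and the natural power is 0 as well because n >= 1.\<close>
    moreover have "sqrt (\<zeta>\<^sup>2 - 1) ^ CARD('n) = g \<zeta>"
    proof (cases "\<zeta>\<^sup>2 - 1 = 0")
      case False
      then show ?thesis
        using \<zeta> by (simp add: g_def powr_half_sqrt[symmetric] powr_realpow[symmetric] powr_powr)
    qed (simp add: g_def)
    ultimately show ?thesis
      using True \<zeta> emeasure_ellipsoid[of "sqrt (\<zeta>\<^sup>2 - 1)"] by (simp add: c_def mult.assoc)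
  next
    case False
    then show ?thesis using b_pos by (auto simp: standard_cut_eq mult_le_cancel_left)
  qed
  have "emeasure lborel ?A = emeasure (lborel \<Otimes>\<^sub>M lborel) ?A"
    by (simp add: lborel_prod)
  also have "\<dots> = (\<integral>\<^sup>+z. emeasure lborel ((\<lambda>x. (x, z)) -` ?A) \<partial>lborel)"
    by (rule lborel_pair.emeasure_pair_measure_alt2[OF borel])
  also have "\<dots> = ennreal \<bar>b\<bar> * (\<integral>\<^sup>+\<zeta>. emeasure lborel ((\<lambda>x. (x, 0 + b * \<zeta>)) -` ?A) \<partial>lborel)"
  proof (rule nn_integral_real_affine)
    show "(\<lambda>z. emeasure lborel ((\<lambda>x. (x, z)) -` ?A)) \<in> borel_measurable borel"
      using lborel_pair.measurable_emeasure_Pair2[OF borel] by simp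
  qed (use b_pos in simp)
  also have "\<dots> = ennreal b * (\<integral>\<^sup>+\<zeta>. ennreal (c * g \<zeta>) * indicator {1..t} \<zeta> \<partial>lborel)"
    using b_pos by (simp add: vimage_def slice)
  also have "(\<integral>\<^sup>+\<zeta>. ennreal (c * g \<zeta>) * indicator {1..t} \<zeta> \<partial>lborel) = ennreal (c * integral {1..t} g)"
  proof (rule nn_integral_has_integral_lebesgue')
    have "continuous_on {1..t} g"
      unfolding g_def by (intro continuous_on_powr') (auto intro!: continuous_intros)
    then show "((\<lambda>\<zeta>. c * g \<zeta>) has_integral c * integral {1..t} g) {1..t}"
      by (intro has_integral_mult_right integrable_integral integrable_continuous_real)
  qed (use c in \<open>simp add: g_def\<close>)
  also have "ennreal b * ennreal (c * integral {1..t} g) = ennreal (G a b t)"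
    using b_pos by (simp add: ennreal_mult'[symmetric] G_def G0_def c_def g_def unit_ball_vol_def mult_ac)
  finally show ?thesis .
qed

lemma G_strict_mono:
  assumes "1 \<le> s" "s < t"
  shows "G a b s < G a b t"
  using assms a_pos b_pos G0_strict_mono[of "CARD('n)" s t]
  by (auto simp: G_def intro!: mult_strict_left_mono mult_pos_pos prod_pos)

text \<open>Volumes are first obtained in \<open>ennreal\<close>, where negative reals collapse to
  0; nonnegativity recovers the real-valued \<open>measure\<close>.\<close>

lemma G_nonneg:
  assumes "1 \<le> t"
  shows "0 \<le> G a b t"
proof -
  have "G a b 1 = 0" by (simp add: G_def G0_def)
  then show ?thesis
    using assms G_strict_mono[of 1 t] by (cases "t = 1") auto
qed

lemma inj_on_G: "inj_on (G a b) {1..}"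
  by (rule linorder_inj_onI') (use G_strict_mono in \<open>auto simp: less_imp_neq\<close>)

text \<open>For \<open>t > 1\<close> the strict inequalities cut out a nonempty open subset, and
  nonempty interior means full affine dimension.\<close>

lemma aff_dim_standard_cut:
  assumes "t > 1"
  shows "aff_dim (upper_cut a b 0 (b * t)) = int CARD('n) + 1"
proof -
  let ?U = "{P :: (real ^ 'n) \<times> real. 0 < snd P \<and> 1 < hyp_form a b P \<and> snd P < b * t}"
  have "open ?U"
    by (intro open_Collect_conj open_Collect_less continuous_intros continuous_on_hyp_form)
  moreover have "?U \<subseteq> upper_cut a b 0 (b * t)"
    by (auto simp: upper_cut_def)
  \<comment> \<open>The point of the z-axis halfway between the vertex \<open>(0, b)\<close> of h =
    1 and the cutting plane.\<close>
  moreover have "(0, b * ((1 + t) / 2)) \<in> ?U"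
  proof -
    have "1 < ((1 + t) / 2)\<^sup>2" using assms by (intro one_less_power) auto
    then show ?thesis using assms b_pos by (simp add: hyp_form_def power_mult_distrib power_divide)
  qed
  ultimately have "interior (upper_cut a b 0 (b * t)) \<noteq> {}"
    by (metis (no_types, lifting) empty_iff interior_maximal subsetD)
  then show ?thesis
    by (simp add: aff_dim_nonempty_interior)
qed

section \<open>Reduction of an arbitrary cut to a horizontal one\<close>

lemma upper_cut_isometric_to_standard:
  fixes m c
  defines "\<delta> \<equiv> b\<^sup>2 - (\<Sum>i\<in>UNIV. (a $ i)\<^sup>2 * (m $ i)\<^sup>2)"
  assumes \<delta>: "\<delta> > 0"
  obtains R where "linear R" "\<And>P. R (R P) = P"
    "upper_cut a b m c = R -` upper_cut a b 0 (b * (c / sqrt \<delta>))"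
proof -
  let ?B = "hyp_bilin a b"
  \<comment> \<open>The unit normal of the hyperplane with respect to \<open>?B\<close>: the
    hyperplane is the level set \<open>?B P u = c / sqrt \<delta>\<close>. The vector
    \<open>e\<close> plays the same role for horizontal hyperplanes.\<close>
  define u where "u = (1 / sqrt \<delta>) *\<^sub>R ((\<chi> i. (a $ i)\<^sup>2 * m $ i) :: real ^ 'n, b\<^sup>2)"
  define e where "e = (0 :: real ^ 'n, b)"
  define v where "v = u + e"
  \<comment> \<open>\<open>R\<close> fixes \<open>v\<close> and negates its
    \<open>?B\<close>-orthogonal complement.\<close>
  define R where "R P = (2 * ?B P v / ?B v v) *\<^sub>R v - P" for P
  have Be: "?B P e = snd P / b" for P
    using b_pos by (simp add: hyp_bilin_def e_def power2_eq_square)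
  have Bu: "?B P u = (snd P - (\<Sum>i\<in>UNIV. m $ i * fst P $ i)) / sqrt \<delta>" for P
  proof -
    have "?B P ((\<chi> i. (a $ i)\<^sup>2 * m $ i), b\<^sup>2) = snd P - (\<Sum>i\<in>UNIV. m $ i * fst P $ i)"
      using a_pos b_pos by (simp add: hyp_bilin_def less_imp_neq[symmetric] mult.commute)
    then show ?thesis by (simp add: u_def hyp_bilin_simps del: scaleR_Pair)
  qed
  have Bee: "?B e e = 1" using b_pos by (simp add: Be) (simp add: e_def)
  have Bue: "?B u e > 0" using b_pos \<delta> by (simp add: Be u_def)
  have Buu: "?B u u = 1"
  proof -
    have "snd u - (\<Sum>i\<in>UNIV. m $ i * fst u $ i) = \<delta> / sqrt \<delta>"
      by (simp add: u_def \<delta>_def diff_divide_distrib sum_divide_distrib power2_eq_square mult_ac)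
    then show ?thesis using \<delta> by (simp add: Bu)
  qed
  \<comment> \<open>As \<open>u\<close> and \<open>e\<close> are unit vectors, both sides equal
    \<open>2 + 2 * ?B u e\<close>. Hence the coefficient of \<open>v\<close> in \<open>R u\<close>
    is 1 and \<open>R u = v - u = e\<close>; positivity makes the quotient in \<open>R\<close>
    meaningful.\<close>
  have Bvv: "?B v v = 2 * ?B u v" "?B u v > 0"
    using Bee Buu Bue by (simp_all add: v_def hyp_bilin_simps hyp_bilin_commute[of a b e u])
  have Ru: "R u = e"
    using Bvv by (simp add: R_def) (simp add: v_def)
  define l where "l P = ?B P v / ?B u v" for P
  have R: "R P = l P *\<^sub>R v - P" for P
    using Bvv(1) by (simp add: R_def l_def)
  have l: "l P * ?B u v = ?B P v" for P
    using Bvv(2) by (simp add: l_def)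
  have lin: "linear R"
    by (rule linearI)
      (simp_all add: R l_def hyp_bilin_simps add_divide_distrib scaleR_add_left scaleR_diff_right)
  have isometry: "?B (R P) (R Q) = ?B P Q" for P Q
  proof -
    have "?B (R P) (R Q) = l P * (l Q * ?B v v) - l P * ?B v Q - (l Q * ?B P v - ?B P Q)"
      by (simp add: R hyp_bilin_simps right_diff_distrib)
    also have "\<dots> = ?B P Q + 2 * l P * (l Q * ?B u v) - l P * ?B Q v - l Q * (l P * ?B u v)"
      using hyp_bilin_commute[of a b v Q] by (simp add: Bvv(1) l)
    also have "\<dots> = ?B P Q + l P * (l Q * ?B u v) - l P * ?B Q v"
      by (simp add: algebra_simps)
    finally show ?thesis by (simp add: l)
  qed
  have invol: "R (R P) = P" for P
  proof -
    have "?B (R P) v = ?B P v"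
      using l[of P] by (simp add: R hyp_bilin_simps Bvv(1))
    then have "l (R P) = l P" by (simp add: l_def)
    then show ?thesis by (simp add: R[of "R P"]) (simp add: R)
  qed
  \<comment> \<open>Because \<open>R\<close> is an isometry with \<open>R u = e\<close>, the
    horizontal level of \<open>R P\<close> is the level of \<open>P\<close> along the tilted normal
    \<open>u\<close>.\<close>
  have Re: "?B (R P) e = ?B P u" for P
    using isometry[of P u] by (simp add: Ru)
  have "P \<in> upper_cut a b m c \<longleftrightarrow> R P \<in> upper_cut a b 0 (b * (c / sqrt \<delta>))" for P
  proof -
    obtain x z where P: "P = (x, z)" by (cases P)
    obtain y w where RP: "R P = (y, w)" by (cases "R P")
    define s where "s = (\<Sum>i\<in>UNIV. m $ i * x $ i)"
    have h: "hyp_form a b (y, w) = hyp_form a b (x, z)"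
      using isometry[of P P] unfolding RP unfolding P by (simp add: hyp_form_eq_bilin)
    have w: "w = b * ((z - s) / sqrt \<delta>)"
      using Re[of P] b_pos unfolding RP unfolding P by (simp add: Be Bu s_def field_simps)
    have le: "w \<le> b * (c / sqrt \<delta>) \<longleftrightarrow> z \<le> s + c"
      using b_pos \<delta> by (auto simp: w divide_le_cancel)
    \<comment> \<open>The last coordinate of \<open>R P\<close> has the sign of z - s, and
      \<open>slope_inequality\<close> gives that the sign of z; so \<open>R\<close> respects the
      upper half-space on h >= 1.\<close>
    have pos: "w > 0 \<longleftrightarrow> z > 0" if "hyp_form a b (x, z) \<ge> 1"
    proof -
      have "\<bar>s\<bar> < \<bar>z\<bar>"
        unfolding s_def using \<delta> that by (intro slope_inequality) (auto simp: \<delta>_def)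
      then have "z - s > 0 \<longleftrightarrow> z > 0" by linarith
      then show ?thesis using b_pos \<delta> by (simp add: w zero_less_mult_iff zero_less_divide_iff)
    qed
    show ?thesis
      unfolding P RP[unfolded P] upper_cut_def using h le pos by (auto simp: s_def)
  qed
  then have "upper_cut a b m c = R -` upper_cut a b 0 (b * (c / sqrt \<delta>))" by auto
  with lin invol show thesis by (rule that)
qed

text \<open>Preimage and image under an involution coincide, so everything transfers from the
  horizontal cut. At ratio 1 that cut is a single point, hence the strict bound in the claim on
  dimension.\<close>

lemma upper_cut_properties:
  fixes m c
  defines "\<delta> \<equiv> b\<^sup>2 - (\<Sum>i\<in>UNIV. (a $ i)\<^sup>2 * (m $ i)\<^sup>2)"
  assumes \<delta>: "\<delta> > 0" and c: "c / sqrt \<delta> \<ge> 1"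
  shows "compact (upper_cut a b m c)"
    and "measure lborel (upper_cut a b m c) = G a b (c / sqrt \<delta>)"
    and "c / sqrt \<delta> > 1 \<Longrightarrow> aff_dim (upper_cut a b m c) = int CARD('n) + 1"
proof -
  let ?S = "upper_cut a b 0 (b * (c / sqrt \<delta>))"
  obtain R where R: "linear R" "\<And>P. R (R P) = P" and vim: "upper_cut a b m c = R -` ?S"
    by (rule upper_cut_isometric_to_standard[of m c, folded \<delta>_def, OF \<delta>]; rule that)
  have img: "upper_cut a b m c = R ` ?S"
    unfolding vim using R(2) by (metis bij_vimage_eq_inv_image inv_equality involuntory_imp_bij)
  show "compact (upper_cut a b m c)"
    unfolding img using R(1)
    by (intro compact_continuous_image linear_continuous_on compact_standard_cut) (simp add: linear_linear)
  have "emeasure lborel (upper_cut a b m c) = emeasure lborel ?S"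
    unfolding vim by (intro emeasure_lborel_linear_involution R borel_closed closed_standard_cut)
  then show "measure lborel (upper_cut a b m c) = G a b (c / sqrt \<delta>)"
    using emeasure_standard_cut[OF c] G_nonneg[OF c] by (simp add: measure_def)
  have "inj R" using R(2) by (metis injI)
  then show "aff_dim (upper_cut a b m c) = int CARD('n) + 1" if "c / sqrt \<delta> > 1"
    unfolding img using R(1) that by (simp only: aff_dim_injective_linear_image aff_dim_standard_cut)
qed

section \<open>Tangent hyperplanes of h = k^2\<close>

definition tangent_slope :: "(real ^ 'n) \<times> real \<Rightarrow> real ^ 'n" where
  "tangent_slope P = (\<chi> i. b\<^sup>2 * fst P $ i / ((a $ i)\<^sup>2 * snd P))"

text \<open>The tangent hyperplane at \<open>P\<close> is the polar hyperplane
  \<open>hyp_bilin a b P Q = k\<^sup>2\<close>; solving for the last coordinate of \<open>Q\<close>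
  gives the slope and the intercept.\<close>

lemma level_tangent_hyperplane_eq:
  assumes "hyp_form a b P = k\<^sup>2" "snd P \<noteq> 0"
  shows "level_tangent_hyperplane (hyp_form a b) P = graph_hyperplane (tangent_slope P) (b\<^sup>2 * k\<^sup>2 / snd P)"
proof -
  have "frechet_derivative (hyp_form a b) (at P) = (\<lambda>h. 2 * hyp_bilin a b P h)"
    using frechet_derivative_at[OF hyp_form_has_derivative[of a b P]] by simp
  then have "level_tangent_hyperplane (hyp_form a b) P = {Q. hyp_bilin a b P Q = k\<^sup>2}"
    using assms by (simp add: level_tangent_hyperplane_def hyp_bilin_simps hyp_form_eq_bilin)
  also have "\<dots> = graph_hyperplane (tangent_slope P) (b\<^sup>2 * k\<^sup>2 / snd P)"
  proof -
    have "hyp_bilin a b P (x, z) = k\<^sup>2 \<longleftrightarrow> z = (\<Sum>i\<in>UNIV. tangent_slope P $ i * x $ i) + b\<^sup>2 * k\<^sup>2 / snd P" for x z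
    proof -
      define S where "S = (\<Sum>i\<in>UNIV. fst P $ i * x $ i / (a $ i)\<^sup>2)"
      have "(\<Sum>i\<in>UNIV. tangent_slope P $ i * x $ i) = b\<^sup>2 / snd P * S"
        unfolding S_def sum_distrib_left by (intro sum.cong) (auto simp: tangent_slope_def mult_ac)
      moreover have "hyp_bilin a b P (x, z) = snd P * z / b\<^sup>2 - S"
        by (simp add: hyp_bilin_def S_def)
      ultimately show ?thesis
        using assms(2) b_pos by (auto simp: field_simps)
    qed
    then show ?thesis by (auto simp: graph_hyperplane_def)
  qed
  finally show ?thesis .
qed

text \<open>A perfect square: on the upper sheet its root, compared with the intercept
  \<open>b\<^sup>2 * k\<^sup>2 / snd P\<close>, leaves the ratio \<open>k\<close> whatever the point
  of tangency. This is why the volume is constant.\<close>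

lemma discriminant_tangent_slope:
  assumes "hyp_form a b P = k\<^sup>2" "snd P \<noteq> 0"
  shows "b\<^sup>2 - (\<Sum>i\<in>UNIV. (a $ i)\<^sup>2 * (tangent_slope P $ i)\<^sup>2) = (b\<^sup>2 * k / snd P)\<^sup>2"
proof -
  define S where "S = (\<Sum>i\<in>UNIV. (fst P $ i)\<^sup>2 / (a $ i)\<^sup>2)"
  have "(\<Sum>i\<in>UNIV. (a $ i)\<^sup>2 * (tangent_slope P $ i)\<^sup>2) = (b\<^sup>2 / snd P)\<^sup>2 * S"
    unfolding S_def sum_distrib_left
    using a_pos by (intro sum.cong) (auto simp: tangent_slope_def power2_eq_square less_imp_neq[symmetric] field_simps)
  moreover have "k\<^sup>2 = (snd P)\<^sup>2 / b\<^sup>2 - S"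
    using assms by (cases P) (simp add: hyp_form_def S_def)
  ultimately show ?thesis
    using assms(2) b_pos by (simp add: power_mult_distrib power_divide) (simp add: field_simps power2_eq_square power4_eq_xxxx)
qed

lemma upper_tangent_cut:
  assumes P: "P \<in> upper_sheet a b (k\<^sup>2)" and k: "k > 1"
  shows "compact (upper_cut a b (tangent_slope P) (b\<^sup>2 * k\<^sup>2 / snd P))"
    and "aff_dim (upper_cut a b (tangent_slope P) (b\<^sup>2 * k\<^sup>2 / snd P)) = int CARD('n) + 1"
    and "measure lborel (upper_cut a b (tangent_slope P) (b\<^sup>2 * k\<^sup>2 / snd P)) = G a b k"
proof -
  have P: "hyp_form a b P = k\<^sup>2" "snd P > 0" using P by (auto simp: upper_sheet_def)
  have disc: "b\<^sup>2 - (\<Sum>i\<in>UNIV. (a $ i)\<^sup>2 * (tangent_slope P $ i)\<^sup>2) = (b\<^sup>2 * k / snd P)\<^sup>2"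
    using P by (intro discriminant_tangent_slope) auto
  have pos: "b\<^sup>2 * k / snd P > 0" using P b_pos k by simp
  then have "sqrt ((b\<^sup>2 * k / snd P)\<^sup>2) = b\<^sup>2 * k / snd P"
    by (simp only: real_sqrt_abs abs_of_pos)
  then have t: "(b\<^sup>2 * k\<^sup>2 / snd P) / sqrt ((b\<^sup>2 * k / snd P)\<^sup>2) = k"
    using P b_pos k by (simp add: field_simps power2_eq_square)
  note props = upper_cut_properties[of "tangent_slope P" "b\<^sup>2 * k\<^sup>2 / snd P", unfolded disc t,
      OF zero_less_power[OF pos] less_imp_le[OF k]]
  show "compact (upper_cut a b (tangent_slope P) (b\<^sup>2 * k\<^sup>2 / snd P))"
    and "aff_dim (upper_cut a b (tangent_slope P) (b\<^sup>2 * k\<^sup>2 / snd P)) = int CARD('n) + 1"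
    and "measure lborel (upper_cut a b (tangent_slope P) (b\<^sup>2 * k\<^sup>2 / snd P)) = G a b k"
    by (fact props(1), fact props(3)[OF k], fact props(2))
qed

text \<open>The reflection z -> -z, again a linear involution, exchanges the sheets and negates both
  slope and intercept.\<close>

lemma lower_tangent_cut:
  assumes P: "P \<in> lower_sheet a b (k\<^sup>2)" and k: "k > 1"
  shows "compact (lower_cut a b (tangent_slope P) (b\<^sup>2 * k\<^sup>2 / snd P))"
    and "aff_dim (lower_cut a b (tangent_slope P) (b\<^sup>2 * k\<^sup>2 / snd P)) = int CARD('n) + 1"
    and "measure lborel (lower_cut a b (tangent_slope P) (b\<^sup>2 * k\<^sup>2 / snd P)) = G a b k"
proof -
  define N :: "(real ^ 'n) \<times> real \<Rightarrow> (real ^ 'n) \<times> real" where "N = (\<lambda>(x, z). (x, - z))"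
  have N: "linear N" "\<And>Q. N (N Q) = Q"
    by (auto intro!: linearI simp: N_def)
  have NP: "N P \<in> upper_sheet a b (k\<^sup>2)"
    using P by (auto simp: upper_sheet_def lower_sheet_def N_def hyp_form_def)
  define U where "U = upper_cut a b (tangent_slope (N P)) (b\<^sup>2 * k\<^sup>2 / snd (N P))"
  have slope: "tangent_slope (N P) = - tangent_slope P" "snd (N P) = - snd P"
    by (auto simp: tangent_slope_def N_def vec_eq_iff split: prod.split)
  have vim: "lower_cut a b (tangent_slope P) (b\<^sup>2 * k\<^sup>2 / snd P) = N -` U"
    unfolding U_def slope
    by (auto simp: lower_cut_def upper_cut_def N_def hyp_form_def sum_negf)
  have img: "N -` U = N ` U"
    using N(2) by (metis bij_vimage_eq_inv_image inv_equality involuntory_imp_bij)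
  note U = upper_tangent_cut[OF NP k, folded U_def]
  show "compact (lower_cut a b (tangent_slope P) (b\<^sup>2 * k\<^sup>2 / snd P))"
    unfolding vim img using N(1) U(1)
    by (intro compact_continuous_image linear_continuous_on) (simp_all add: linear_linear)
  have "inj N" using N(2) by (metis injI)
  then show "aff_dim (lower_cut a b (tangent_slope P) (b\<^sup>2 * k\<^sup>2 / snd P)) = int CARD('n) + 1"
    unfolding vim img using N(1) U(2) by (simp add: aff_dim_injective_linear_image)
  have "emeasure lborel (N -` U) = emeasure lborel U"
    using U(1) by (intro emeasure_lborel_linear_involution N borel_closed compact_imp_closed)
  then show "measure lborel (lower_cut a b (tangent_slope P) (b\<^sup>2 * k\<^sup>2 / snd P)) = G a b k"
    using U(3) by (simp add: vim measure_def)
qed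

end

subsection \<open>Solutions of the Clairaut equation\<close>

text \<open>
  At a critical point of \<open>ln \<psi> + \<epsilon> * ln f\<close> one has \<open>x = (f + \<eta> / f) *\<^sub>R p\<close> with \<open>\<eta> = \<epsilon> * \<psi> / 2\<close>;
  below, \<open>P\<close> stands for the squared norm of \<open>p\<close>.
\<close>

lemma critical_point_estimate:
  fixes f k \<eta> P \<psi> :: real
  assumes f: "f > 0" and \<eta>: "\<eta> \<ge> 0" and P: "0 \<le> P" "P < 1"
    and support: "f - (f + \<eta> / f) * P = k * sqrt (1 - P)"
    and psi: "\<psi> = f\<^sup>2 - (f + \<eta> / f)\<^sup>2 * P" "1 \<le> \<psi>"
  shows "k\<^sup>2 - \<eta>\<^sup>2 \<le> \<psi>"
proof -
  define D where "D = 1 - P"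
  have D: "0 < D" "P = 1 - D" using P by (auto simp: D_def)
  have "k\<^sup>2 * D = (f - (f + \<eta> / f) * P)\<^sup>2"
    using support D by (simp add: power_mult_distrib)
  then have "(k\<^sup>2 - \<psi>) * D = (f - (f + \<eta> / f) * P)\<^sup>2 - \<psi> * D"
    by (simp add: algebra_simps)
  \<comment> \<open>With g = f + \<eta>/f, expansion gives (f - g P)^2 - (f^2 - g^2 P)(1 - P) = P (g
    - f)^2.\<close>
  also have "\<dots> = \<eta>\<^sup>2 * P / f\<^sup>2"
    unfolding psi(1) D(2) using f by (simp add: field_simps power2_eq_square)
  also have "\<dots> \<le> \<eta>\<^sup>2 / f\<^sup>2"
    using P by (intro divide_right_mono) (auto simp: mult_left_le)
  \<comment> \<open>From \<psi> >= 1 and f + \<eta>/f >= f follows 1 <= f^2 (1 - P), that is, 1/f^2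
    <= D; this allows \<open>D\<close> to be cancelled at the end.\<close>
  also have "\<dots> \<le> \<eta>\<^sup>2 * D"
  proof -
    have "f\<^sup>2 * P \<le> (f + \<eta> / f)\<^sup>2 * P"
      using f \<eta> P by (intro mult_right_mono power_mono) auto
    then have "1 \<le> f\<^sup>2 * D"
      using psi by (simp add: D_def algebra_simps)
    then have "\<eta>\<^sup>2 * 1 \<le> \<eta>\<^sup>2 * (f\<^sup>2 * D)"
      by (intro mult_left_mono) auto
    then show ?thesis using f by (simp add: field_simps)
  qed
  finally show ?thesis using D by simp
qed

text \<open>Cauchy-Schwarz twice: for p and x, then in the plane for the unit vector (|p|, q) and
  (|x|, k), the latter through Lagrange's identity. Geometrically, the supporting planes lie below
  their envelope z^2 = |x|^2 + k^2, z > 0.\<close>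

lemma envelope_upper_bound:
  fixes x p :: "'a::real_inner" and f k :: real
  assumes "norm p < 1" "k \<ge> 0" "f > 0" and support: "f - p \<bullet> x = k * sqrt (1 - (norm p)\<^sup>2)"
  shows "f\<^sup>2 - (norm x)\<^sup>2 \<le> k\<^sup>2"
proof -
  define q where "q = sqrt (1 - (norm p)\<^sup>2)"
  have "(norm p)\<^sup>2 < 1" using assms(1) by (simp add: abs_square_less_1)
  then have q: "q\<^sup>2 = 1 - (norm p)\<^sup>2" "q \<ge> 0" by (auto simp: q_def)
  have "f \<le> norm p * norm x + q * k"
    using support Cauchy_Schwarz_ineq2[of p x] by (simp add: q_def mult.commute)
  then have "f\<^sup>2 \<le> (norm p * norm x + q * k)\<^sup>2"
    using assms by (intro power_mono) auto
  also have "\<dots> = ((norm p)\<^sup>2 + q\<^sup>2) * ((norm x)\<^sup>2 + k\<^sup>2) - (norm p * k - q * norm x)\<^sup>2"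
    by algebra
  also have "\<dots> \<le> (norm x)\<^sup>2 + k\<^sup>2" using q by simp
  finally show ?thesis by simp
qed

lemma support_eq_imp_hyperboloid:
  fixes f :: "'a::euclidean_space \<Rightarrow> real" and p :: "'a \<Rightarrow> 'a"
  assumes der: "\<And>x. (f has_derivative (\<lambda>h. p x \<bullet> h)) (at x)"
    and p: "\<And>x. norm (p x) < 1"
    and support: "\<And>x. f x - p x \<bullet> x = k * sqrt (1 - (norm (p x))\<^sup>2)"
    and k: "k > 0" and f: "\<And>x. f x > 0" and inside: "\<And>x. (f x)\<^sup>2 - (norm x)\<^sup>2 > 1"
  shows "(f x)\<^sup>2 - (norm x)\<^sup>2 = k\<^sup>2"
proof -
  define \<psi> where "\<psi> x = (f x)\<^sup>2 - (norm x)\<^sup>2" for x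
  have psi1: "\<psi> x > 1" for x using inside by (simp add: \<psi>_def)
  have psik: "\<psi> x \<le> k\<^sup>2" for x
    unfolding \<psi>_def by (rule envelope_upper_bound[OF p less_imp_le[OF k] f support])
  have f1: "f x > 1" for x
  proof -
    have "(f x)\<^sup>2 > 1" using inside[of x] zero_le_power2[of "norm x"] by linarith
    then show ?thesis using f[of x] power_less_imp_less_base[of 1 2 "f x"] by simp
  qed
  have fx: "f x > norm x" for x
    using inside[of x] f[of x] by (intro power_less_imp_less_base[of "norm x" 2 "f x"]) simp_all
  have psi_alt: "\<psi> = (\<lambda>x. (f x)\<^sup>2 - x \<bullet> x)" by (auto simp: \<psi>_def power2_norm_eq_inner)
  \<comment> \<open>The minimiser depends on \<epsilon>, so the estimate is passed on to a fixed
    \<open>x0\<close>. The second condition keeps the argument of the left logarithm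
    positive.\<close>
  have bound: "ln (k\<^sup>2 - (\<epsilon> * k\<^sup>2 / 2)\<^sup>2) \<le> ln (\<psi> x0) + \<epsilon> * ln (f x0)"
    if \<epsilon>: "\<epsilon> > 0" "0 < k\<^sup>2 - (\<epsilon> * k\<^sup>2 / 2)\<^sup>2" for \<epsilon> x0
  proof -
    define \<phi> where "\<phi> x = ln (\<psi> x) + \<epsilon> * ln (f x)" for x
    have dphi: "(\<phi> has_derivative (\<lambda>h. (2 * f x * (p x \<bullet> h) - 2 * (x \<bullet> h)) / \<psi> x + \<epsilon> * ((p x \<bullet> h) / f x))) (at x)" for x
    proof -
      have pos: "0 < (f x)\<^sup>2 - x \<bullet> x" using psi1[of x] by (simp add: psi_alt)
      have "((\<lambda>x. (f x)\<^sup>2 - x \<bullet> x) has_derivative (\<lambda>h. 2 * f x * (p x \<bullet> h) - 2 * (x \<bullet> h))) (at x)"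
        by (rule derivative_eq_intros der refl | simp add: inner_commute fun_eq_iff)+
      from has_derivative_ln[OF pos this] has_derivative_mult_right[OF has_derivative_ln[OF f der], of \<epsilon> x]
      show ?thesis
        unfolding \<phi>_def psi_alt
        by (rule has_derivative_eq_rhs[OF has_derivative_add]) (auto simp: divide_inverse mult_ac)
    qed
    \<comment> \<open>Outside this ball, \<psi> > 1 and f y > |y| give \<phi> y >= \<epsilon> ln (f
      y) >= \<phi> x0. As \<open>x0\<close> lies in the ball, a minimum over the ball is
      global.\<close>
    define r where "r = max 1 (max (norm x0) (exp (\<phi> x0 / \<epsilon>)))"
    have "continuous_on (cball 0 r) \<phi>"
      using dphi by (meson continuous_at_imp_continuous_on has_derivative_continuous)
    then obtain x1 where x1: "x1 \<in> cball 0 r" "\<And>y. y \<in> cball 0 r \<Longrightarrow> \<phi> x1 \<le> \<phi> y"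
      using continuous_attains_inf[of "cball 0 r" \<phi>] by (auto simp: r_def)
    have x1x0: "\<phi> x1 \<le> \<phi> x0" by (rule x1(2)) (simp add: r_def)
    have min: "\<phi> x1 \<le> \<phi> y" for y
    proof (cases "y \<in> cball 0 r")
      case False
      then have y: "norm y > 1" "exp (\<phi> x0 / \<epsilon>) < norm y" by (auto simp: r_def)
      have "\<phi> x0 / \<epsilon> = ln (exp (\<phi> x0 / \<epsilon>))" by simp
      also have "\<dots> \<le> ln (f y)" using y fx[of y] f[of y] by (subst ln_le_cancel_iff) auto
      finally have "\<phi> x0 \<le> \<epsilon> * ln (f y)" using \<epsilon> by (simp add: field_simps)
      also have "\<dots> \<le> \<phi> y" using psi1[of y] by (simp add: \<phi>_def)
      finally show ?thesis using x1x0 by simp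
    qed (rule x1(2))
    define \<eta> where "\<eta> = \<epsilon> * \<psi> x1 / 2"
    have zero: "(\<lambda>h. (2 * f x1 * (p x1 \<bullet> h) - 2 * (x1 \<bullet> h)) / \<psi> x1 + \<epsilon> * ((p x1 \<bullet> h) / f x1)) = (\<lambda>h. 0)"
      by (rule differential_zero_maxmin[of x1 UNIV, OF _ _ dphi]) (use min in auto)
    have "x1 \<bullet> h = ((f x1 + \<eta> / f x1) *\<^sub>R p x1) \<bullet> h" for h
    proof -
      have "2 * f x1 * (p x1 \<bullet> h) - 2 * (x1 \<bullet> h) + \<epsilon> * (p x1 \<bullet> h) * \<psi> x1 / f x1 = 0"
        using arg_cong[OF fun_cong[OF zero, of h], of "\<lambda>t. t * \<psi> x1"] psi1[of x1]
        by (simp add: distrib_right)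
      then show ?thesis
        using f[of x1] by (simp add: \<eta>_def field_simps)
    qed
    then have crit: "x1 = (f x1 + \<eta> / f x1) *\<^sub>R p x1"
      by (metis vector_eq_rdot)
    define P where "P = p x1 \<bullet> p x1"
    have P: "P = (norm (p x1))\<^sup>2" "0 \<le> P" by (auto simp: P_def power2_norm_eq_inner)
    have inn: "p x1 \<bullet> x1 = (f x1 + \<eta> / f x1) * P"
      by (subst (2) crit) (simp add: P_def)
    have "x1 \<bullet> x1 = (f x1 + \<eta> / f x1)\<^sup>2 * P"
      by (subst crit, subst (2) crit) (simp add: P_def power2_eq_square)
    then have "\<psi> x1 = (f x1)\<^sup>2 - (f x1 + \<eta> / f x1)\<^sup>2 * P"
      by (simp add: psi_alt)
    moreover have "P < 1" using p[of x1] unfolding P(1) by (simp add: abs_square_less_1)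
    moreover have "f x1 - (f x1 + \<eta> / f x1) * P = k * sqrt (1 - P)"
      using support[of x1] inn P by simp
    ultimately have "k\<^sup>2 - \<eta>\<^sup>2 \<le> \<psi> x1"
      using f[of x1] P(2) psi1[of x1] \<epsilon> by (intro critical_point_estimate) (auto simp: \<eta>_def)
    \<comment> \<open>The envelope bound \<psi> <= k^2 makes the error independent of the
      minimiser.\<close>
    moreover have "\<eta>\<^sup>2 \<le> (\<epsilon> * k\<^sup>2 / 2)\<^sup>2"
      using psik[of x1] psi1[of x1] \<epsilon> by (intro power_mono) (auto simp: \<eta>_def)
    ultimately have "ln (k\<^sup>2 - (\<epsilon> * k\<^sup>2 / 2)\<^sup>2) \<le> ln (\<psi> x1)"
      using \<epsilon> psi1[of x1] by (subst ln_le_cancel_iff) auto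
    also have "\<dots> \<le> \<phi> x1" using f1[of x1] \<epsilon> by (simp add: \<phi>_def)
    also note x1x0
    finally show ?thesis by (simp add: \<phi>_def)
  qed
  have lim: "((\<lambda>\<epsilon>. k\<^sup>2 - (\<epsilon> * k\<^sup>2 / 2)\<^sup>2) \<longlongrightarrow> k\<^sup>2 - (0 * k\<^sup>2 / 2)\<^sup>2) (at_right 0)"
    by (intro tendsto_intros) auto
  \<comment> \<open>Now \<epsilon> tends to 0 with \<open>x\<close> fixed; since
    \<open>k > 0\<close>, the positivity condition of \<open>bound\<close> holds for all small
    \<epsilon>. The factors 0 stay unevaluated to match the form of the limits.\<close>
  have "ln (k\<^sup>2 - (0 * k\<^sup>2 / 2)\<^sup>2) \<le> ln (\<psi> x) + 0 * ln (f x)"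
  proof (rule tendsto_le[OF trivial_limit_at_right_real])
    show "((\<lambda>\<epsilon>. ln (\<psi> x) + \<epsilon> * ln (f x)) \<longlongrightarrow> ln (\<psi> x) + 0 * ln (f x)) (at_right 0)"
      by (intro tendsto_intros)
    show "((\<lambda>\<epsilon>. ln (k\<^sup>2 - (\<epsilon> * k\<^sup>2 / 2)\<^sup>2)) \<longlongrightarrow> ln (k\<^sup>2 - (0 * k\<^sup>2 / 2)\<^sup>2)) (at_right 0)"
      using k by (intro tendsto_ln lim) auto
    have "\<forall>\<^sub>F \<epsilon> in at_right 0. 0 < k\<^sup>2 - (\<epsilon> * k\<^sup>2 / 2)\<^sup>2"
      using lim k by (intro order_tendstoD(1)[OF lim]) auto
    moreover have "\<forall>\<^sub>F \<epsilon>::real in at_right 0. 0 < \<epsilon>" by (rule eventually_at_right_less)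
    ultimately show "\<forall>\<^sub>F \<epsilon> in at_right 0. ln (k\<^sup>2 - (\<epsilon> * k\<^sup>2 / 2)\<^sup>2) \<le> ln (\<psi> x) + \<epsilon> * ln (f x)"
      by eventually_elim (rule bound)
  qed
  then have "k\<^sup>2 \<le> \<psi> x" using k psi1[of x] by (simp add: ln_le_cancel_iff)
  then show ?thesis using psik[of x] by (simp add: \<psi>_def)
qed

section \<open>Partial derivatives and the passage to arbitrary semi-axes\<close>

lemma gradient_derivative:
  fixes f :: "real ^ 'n \<Rightarrow> real"
  assumes "(f has_derivative f') (at x)"
  shows "f' h = (\<Sum>i\<in>UNIV. partial_deriv f i x * h $ i)"
proof -
  have lin: "linear f'" using assms by (rule has_derivative_linear)
  have partial: "partial_deriv f i x = f' (axis i 1)" for i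
  proof -
    have "((\<lambda>t. x + t *\<^sub>R axis i 1) has_derivative (\<lambda>t. t *\<^sub>R axis i 1)) (at 0)"
      by (auto intro!: derivative_eq_intros)
    then have "((\<lambda>t. f (x + t *\<^sub>R axis i 1)) has_derivative (\<lambda>t. f' (t *\<^sub>R axis i 1))) (at 0)"
      using has_derivative_compose[of "\<lambda>t. x + t *\<^sub>R axis i 1" _ 0 UNIV f f'] assms by simp
    then have "((\<lambda>t. f (x + t *\<^sub>R axis i 1)) has_field_derivative f' (axis i 1)) (at 0)"
      using lin by (simp add: has_field_derivative_def linear_scale mult.commute[of _ "f' (axis i 1)"])
    then show ?thesis by (simp add: partial_deriv_def DERIV_imp_deriv)
  qed
  have "f' h = f' (\<Sum>i\<in>UNIV. h $ i *\<^sub>R axis i 1)"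
    using basis_expansion[of h] by (simp add: scalar_mult_eq_scaleR)
  also have "\<dots> = (\<Sum>i\<in>UNIV. partial_deriv f i x * h $ i)"
    using lin by (simp add: linear_sum linear_scale partial mult.commute)
  finally show ?thesis .
qed

context hyperboloid
begin

text \<open>Rescaling by \<open>D\<close> and \<open>b\<close> turns h into z^2 - |y|^2. The
  gradient \<open>p\<close> of \<open>F\<close> then satisfies 1 - |p|^2 = \<delta>/b^2 and the
  intercept is divided by \<open>b\<close>, so the Clairaut equation keeps the same constant
  \<open>k\<close>.\<close>

lemma tangent_support_imp_hyperboloid:
  fixes f :: "real ^ 'n \<Rightarrow> real"
  defines "\<delta> \<equiv> \<lambda>x. b\<^sup>2 - (\<Sum>i\<in>UNIV. (a $ i)\<^sup>2 * (partial_deriv f i x)\<^sup>2)"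
  assumes diff: "\<And>x. f differentiable (at x)"
    and inside: "\<And>x. f x > 0" "\<And>x. hyp_form a b (x, f x) > 1"
    and \<delta>: "\<And>x. \<delta> x > 0" and k: "k > 0"
    and support: "\<And>x. tangent_intercept f x = k * sqrt (\<delta> x)"
  shows "hyp_form a b (x, f x) = k\<^sup>2"
proof -
  define D :: "real ^ 'n \<Rightarrow> real ^ 'n" where "D y = (\<chi> i. a $ i * y $ i)" for y
  define F where "F y = f (D y) / b" for y
  define p :: "real ^ 'n \<Rightarrow> real ^ 'n" where "p y = (\<chi> i. a $ i * partial_deriv f i (D y) / b)" for y
  have linD: "linear D" by (rule linearI) (auto simp: D_def vec_eq_iff algebra_simps)
  have form: "(F y)\<^sup>2 - (norm y)\<^sup>2 = hyp_form a b (D y, f (D y))" for y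
    using a_pos
    by (simp add: F_def D_def hyp_form_def power2_norm_eq_inner inner_vec_def power_divide
        power_mult_distrib less_imp_neq[symmetric] flip: power2_eq_square)
  have norm_p: "(norm (p y))\<^sup>2 = 1 - \<delta> (D y) / b\<^sup>2" for y
    using b_pos
    by (simp add: p_def \<delta>_def power2_norm_eq_inner inner_vec_def power_divide diff_divide_distrib
        power_mult_distrib sum_divide_distrib flip: power2_eq_square)
  have "(F y)\<^sup>2 - (norm y)\<^sup>2 = k\<^sup>2" for y
  proof (rule support_eq_imp_hyperboloid)
    fix y
    show "(F has_derivative (\<lambda>h. p y \<bullet> h)) (at y)"
    proof -
      obtain f' where f': "(f has_derivative f') (at (D y))"
        using diff by (auto simp: differentiable_def)
      have "(D has_derivative D) (at y)"
        using linD by (simp add: bounded_linear_imp_has_derivative linear_linear)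
      from has_derivative_compose[OF this f']
      have "(F has_derivative (\<lambda>h. f' (D h) / b)) (at y)"
        unfolding F_def using b_pos by (auto intro!: derivative_eq_intros)
      moreover have "f' (D h) / b = p y \<bullet> h" for h
        by (simp add: gradient_derivative[OF f'] p_def D_def inner_vec_def sum_divide_distrib mult_ac)
      ultimately show ?thesis by simp
    qed
    show "norm (p y) < 1"
    proof -
      have "(norm (p y))\<^sup>2 < 1" using \<delta>[of "D y"] b_pos by (simp add: norm_p)
      then show ?thesis by (simp add: abs_square_less_1)
    qed
    show "F y - p y \<bullet> y = k * sqrt (1 - (norm (p y))\<^sup>2)"
    proof -
      have "F y - p y \<bullet> y = tangent_intercept f (D y) / b"
        by (simp add: F_def p_def D_def tangent_intercept_def inner_vec_def diff_divide_distrib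
            sum_divide_distrib mult_ac)
      also have "\<dots> = k * sqrt (1 - (norm (p y))\<^sup>2)"
        using b_pos by (simp add: support norm_p real_sqrt_divide)
      finally show ?thesis .
    qed
    show "F y > 0" using inside b_pos by (simp add: F_def)
    show "(F y)\<^sup>2 - (norm y)\<^sup>2 > 1" using inside by (simp add: form)
  qed (rule k)
  \<comment> \<open>\<open>D\<close> is onto, so the identity for \<open>F\<close> reaches every
    point of the original graph.\<close>
  moreover have "D (\<chi> i. x $ i / a $ i) = x"
    using a_pos by (simp add: D_def vec_eq_iff less_imp_neq[symmetric])
  ultimately show ?thesis by (metis form)
qed

text \<open>Over each x the equation h = c determines z^2, so the upper sheet has no point besides
  the one on the graph.\<close>

lemma graph_eq_upper_sheet:
  assumes "\<And>x. f x > 0" "\<And>x. hyp_form a b (x, f x) = c"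
  shows "{(x, z). z = f x} = upper_sheet a b c"
proof -
  have "z = f x" if "hyp_form a b (x, z) = c" "z > 0" for x z
  proof -
    have "z\<^sup>2 / b\<^sup>2 = (f x)\<^sup>2 / b\<^sup>2"
      using that(1) assms(2)[of x] unfolding hyp_form_def prod.case by linarith
    then have "z\<^sup>2 = (f x)\<^sup>2" using b_pos by simp
    then show ?thesis using that(2) assms(1)[of x] by (simp add: power2_eq_iff_nonneg)
  qed
  then show ?thesis using assms by (auto simp: upper_sheet_def)
qed

text \<open>\<open>K x\<close> is the height parameter of the horizontal cut equivalent to the
  tangent cut at \<open>x\<close>. The intercept condition places it in \<open>{1..}\<close>, where
  \<open>G\<close> is injective, so constant volume forces a constant parameter.\<close>

lemma constant_cut_volume_imp_hyperboloid:
  fixes f :: "real ^ 'n \<Rightarrow> real"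
  defines "\<delta> \<equiv> \<lambda>x. b\<^sup>2 - (\<Sum>i\<in>UNIV. (a $ i)\<^sup>2 * (partial_deriv f i x)\<^sup>2)"
  assumes diff: "\<And>x. f differentiable (at x)"
    and inside: "\<And>x. f x > 0" "\<And>x. hyp_form a b (x, f x) > 1"
    and \<delta>: "\<And>x. \<delta> x > 0" and intercept: "\<And>x. tangent_intercept f x \<ge> sqrt (\<delta> x)"
    and volume: "\<And>x. measure lborel (upper_cut a b (gradient f x) (tangent_intercept f x)) = V"
  shows "\<exists>k>1. G a b k = V \<and> k = G_inv a b V \<and> {(x, z). z = f x} = upper_sheet a b (k\<^sup>2)"
proof -
  define K where "K x = tangent_intercept f x / sqrt (\<delta> x)" for x
  have K1: "K x \<ge> 1" for x using \<delta>[of x] intercept[of x] by (simp add: K_def)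
  have GK: "G a b (K x) = V" for x
    using upper_cut_properties(2)[of "gradient f x" "tangent_intercept f x"] \<delta>[of x] K1[of x] volume[of x]
    by (simp add: gradient_def \<delta>_def K_def)
  define k where "k = K 0"
  have k1: "k \<ge> 1" "G a b k = V" using K1 GK by (simp_all add: k_def)
  have K: "K x = k" for x
    using inj_onD[OF inj_on_G, of "K x" k] GK[of x] K1[of x] k1 by simp
  have support: "tangent_intercept f x = k * sqrt (\<delta> x)" for x
    using K[of x] \<delta>[of x] by (simp add: K_def field_simps)
  have form: "hyp_form a b (x, f x) = k\<^sup>2" for x
    using k1 \<delta> support unfolding \<delta>_def
    by (intro tangent_support_imp_hyperboloid diff inside) auto
  \<comment> \<open>The value 1 would put the graph on h = 1 itself, whereas it lies strictly
    inside.\<close>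
  have "k \<noteq> 1" using inside(2)[of 0] form[of 0] by auto
  then have "k > 1" using k1 by simp
  moreover have "k = G_inv a b V"
    using the_inv_into_f_f[OF inj_on_G, of k] k1 by (simp add: G_inv_def)
  ultimately show ?thesis
    using k1 graph_eq_upper_sheet[OF inside(1) form] by blast
qed

end

lemma C2_imp_differentiable: "C2 f \<Longrightarrow> f differentiable (at x)"
  unfolding C2_def differentiable_def by blast

text \<open>The affine dimension expresses that a cut is a genuine (n+1)-dimensional set. As
  \<open>G_inv\<close> is unspecified off the range of \<open>G\<close>, the conclusion also states
  \<open>G a b k = V\<close>, so that V is a value of \<open>G\<close>.\<close>

theorem theorem3:
  fixes a :: "real ^ 'n" and b :: real
  assumes a_pos: "\<And>i. a $ i > 0" and b_pos: "b > 0"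
  shows
    "(\<forall>k>1.
        (\<forall>P \<in> upper_sheet a b (k\<^sup>2). \<exists>m c.
           level_tangent_hyperplane (hyp_form a b) P = graph_hyperplane m c \<and>
           compact (upper_cut a b m c) \<and>
           aff_dim (upper_cut a b m c) = int CARD('n) + 1 \<and>
           measure lborel (upper_cut a b m c) = G a b k) \<and>
        (\<forall>P \<in> lower_sheet a b (k\<^sup>2). \<exists>m c.
           level_tangent_hyperplane (hyp_form a b) P = graph_hyperplane m c \<and>
           compact (lower_cut a b m c) \<and>
           aff_dim (lower_cut a b m c) = int CARD('n) + 1 \<and>
           measure lborel (lower_cut a b m c) = G a b k))
     \<and>
     (\<forall>(f :: real ^ 'n \<Rightarrow> real) (V :: real).
        C2 f \<longrightarrow>
        (\<forall>x. f x > 0 \<and> hyp_form a b (x, f x) > 1) \<longrightarrow>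
        (\<forall>x. b\<^sup>2 - (\<Sum>i\<in>UNIV. (a $ i)\<^sup>2 * (partial_deriv f i x)\<^sup>2) > 0 \<and>
             f x - (\<Sum>i\<in>UNIV. partial_deriv f i x * x $ i)
               \<ge> sqrt (b\<^sup>2 - (\<Sum>i\<in>UNIV. (a $ i)\<^sup>2 * (partial_deriv f i x)\<^sup>2)) \<and>
             compact (upper_cut a b (gradient f x) (tangent_intercept f x)) \<and>
             measure lborel (upper_cut a b (gradient f x) (tangent_intercept f x)) = V) \<longrightarrow>
        (\<exists>k>1. G a b k = V \<and> k = G_inv a b V \<and>
               {(x, z). z = f x} = upper_sheet a b (k\<^sup>2)))"
proof -
  interpret hyperboloid a b
    by standard (rule a_pos, rule b_pos)
  show ?thesis
  proof (intro conjI allI impI ballI)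
    fix k :: real and P
    assume k: "k > 1"
    show "\<exists>m c. level_tangent_hyperplane (hyp_form a b) P = graph_hyperplane m c \<and>
           compact (upper_cut a b m c) \<and> aff_dim (upper_cut a b m c) = int CARD('n) + 1 \<and>
           measure lborel (upper_cut a b m c) = G a b k" if P: "P \<in> upper_sheet a b (k\<^sup>2)"
    proof -
      have "level_tangent_hyperplane (hyp_form a b) P = graph_hyperplane (tangent_slope P) (b\<^sup>2 * k\<^sup>2 / snd P)"
        using P by (intro level_tangent_hyperplane_eq) (auto simp: upper_sheet_def)
      with upper_tangent_cut[OF P k] show ?thesis by blast
    qed
    show "\<exists>m c. level_tangent_hyperplane (hyp_form a b) P = graph_hyperplane m c \<and>
           compact (lower_cut a b m c) \<and> aff_dim (lower_cut a b m c) = int CARD('n) + 1 \<and>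
           measure lborel (lower_cut a b m c) = G a b k" if P: "P \<in> lower_sheet a b (k\<^sup>2)"
    proof -
      have "level_tangent_hyperplane (hyp_form a b) P = graph_hyperplane (tangent_slope P) (b\<^sup>2 * k\<^sup>2 / snd P)"
        using P by (intro level_tangent_hyperplane_eq) (auto simp: lower_sheet_def)
      with lower_tangent_cut[OF P k] show ?thesis by blast
    qed
  next
    fix f :: "real ^ 'n \<Rightarrow> real" and V :: real
    assume "C2 f" and inside: "\<forall>x. f x > 0 \<and> hyp_form a b (x, f x) > 1"
      and tangent: "\<forall>x. b\<^sup>2 - (\<Sum>i\<in>UNIV. (a $ i)\<^sup>2 * (partial_deriv f i x)\<^sup>2) > 0 \<and>
             f x - (\<Sum>i\<in>UNIV. partial_deriv f i x * x $ i)
               \<ge> sqrt (b\<^sup>2 - (\<Sum>i\<in>UNIV. (a $ i)\<^sup>2 * (partial_deriv f i x)\<^sup>2)) \<and>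
             compact (upper_cut a b (gradient f x) (tangent_intercept f x)) \<and>
             measure lborel (upper_cut a b (gradient f x) (tangent_intercept f x)) = V"
    show "\<exists>k>1. G a b k = V \<and> k = G_inv a b V \<and> {(x, z). z = f x} = upper_sheet a b (k\<^sup>2)"
      using \<open>C2 f\<close> inside tangent
      by (intro constant_cut_volume_imp_hyperboloid C2_imp_differentiable)
        (auto simp: tangent_intercept_def)
  qed
qed

end
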